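(* Let $n,k$ be positive integers with $n\geq 2k+1$, let $t\in\{0,1,\dots,k-1\}$ and $S=\{0,1,\dots,t\}$. Then \[Z(J_S(n,k))\geq\binom{n}{k}-\binom{2k-2t}{k-t}.\]
   Context: For $S\subseteq\{0,1,\dots,k-1\}$, the generalized Johnson graph $J_S(n,k)$ is the simple graph whose vertices are the $k$-element subsets of $\{1,\dots,n\}$, two distinct vertices being adjacent if and only if the size of their intersection lies in $S$. Zero forcing on a graph $G$: start with a set of black vertices, all others white; repeatedly, if a black vertex $v$ has exactly one white neighbor $w$, color $w$ black. A zero forcing set is an initial black set for which this eventually colors all vertices black; $Z(G)$ is the minimum size of a zero forcing set. *)

theory Defs
  imports Main "Graph_Theory.Pair_Digraph"
begin

(* Simple graphs are the library's pair_graph: finite, loop-free, with a symmetric set of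
   vertex pairs as arcs. *)

definition gen_johnson :: "nat set \<Rightarrow> nat \<Rightarrow> nat \<Rightarrow> nat set pair_pre_digraph" where
  "gen_johnson S n k =
     \<lparr> pverts = {A. A \<subseteq> {1..n} \<and> card A = k},
       parcs = {(A, B). A \<subseteq> {1..n} \<and> card A = k \<and> B \<subseteq> {1..n} \<and> card B = k \<and>
                        A \<noteq> B \<and> card (A \<inter> B) \<in> S} \<rparr>"

definition white_neighbors :: "'a pair_pre_digraph \<Rightarrow> 'a set \<Rightarrow> 'a \<Rightarrow> 'a set" where
  "white_neighbors G B v = {w \<in> pverts G - B. (v, w) \<in> parcs G}"

definition force_step :: "'a pair_pre_digraph \<Rightarrow> 'a set \<Rightarrow> 'a set \<Rightarrow> bool" where
  "force_step G B B' \<longleftrightarrow> (\<exists>v w. v \<in> B \<and> white_neighbors G B v = {w} \<and> B' = insert w B)"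

definition zero_forcing_set :: "'a pair_pre_digraph \<Rightarrow> 'a set \<Rightarrow> bool" where
  "zero_forcing_set G B \<longleftrightarrow> B \<subseteq> pverts G \<and> (force_step G)\<^sup>*\<^sup>* B (pverts G)"

definition zero_forcing_number :: "'a pair_pre_digraph \<Rightarrow> nat" where
  "zero_forcing_number G = (LEAST m. \<exists>B. zero_forcing_set G B \<and> card B = m)"

lemma pair_graph_gen_johnson: "pair_graph (gen_johnson S n k)"
proof unfold_locales
  let ?G = "gen_johnson S n k"
  have fin: "finite (pverts ?G)"
    unfolding gen_johnson_def by (simp add: finite_subset[of _ "Pow {1..n}"])
  have sub: "parcs ?G \<subseteq> pverts ?G \<times> pverts ?G"
    unfolding gen_johnson_def by auto
  show "finite (pverts ?G)" by (rule fin)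
  show "finite (parcs ?G)" by (rule finite_subset[OF sub finite_cartesian_product[OF fin fin]])
  show "symmetric (with_proj ?G)"
    unfolding symmetric_def with_proj_simps
  proof (rule symI)
    fix A B assume AB: "(A, B) \<in> parcs ?G"
    then have "A \<noteq> B" by (simp add: gen_johnson_def)
    with AB not_sym[OF this] show "(B, A) \<in> parcs ?G" by (simp add: gen_johnson_def Int_commute)
  qed
  fix e assume e: "e \<in> parcs ?G"
  show "fst e \<in> pverts ?G" "snd e \<in> pverts ?G"
    using subsetD[OF sub e] by (simp_all add: mem_Times_iff)
  show "fst e \<noteq> snd e"
    using e by (simp add: gen_johnson_def case_prod_unfold)
qed

lemma zero_forcing_set_pverts: "zero_forcing_set G (pverts G)"
  by (simp add: zero_forcing_set_def)

lemma zero_forcing_number_attained: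
  "\<exists>B. zero_forcing_set G B \<and> card B = zero_forcing_number G"
  unfolding zero_forcing_number_def
proof (rule LeastI_ex)
  have "zero_forcing_set G (pverts G) \<and> card (pverts G) = card (pverts G)"
    by (simp add: zero_forcing_set_pverts)
  then show "\<exists>m B. zero_forcing_set G B \<and> card B = m" by (intro exI)
qed

lemma zero_forcing_number_le:
  assumes "zero_forcing_set G B"
  shows "zero_forcing_number G \<le> card B"
  unfolding zero_forcing_number_def
  by (rule Least_le, rule exI[of _ B]) (simp add: assms)

end

theory Submission
  imports Defs "Jordan_Normal_Form.Determinant"
begin

text \<open>
  List the forces \<open>v\<^sub>i \<rightarrow> w\<^sub>i\<close> in chronological order. Then \<open>v\<^sub>i\<close> and \<open>w\<^sub>i\<close> meet in at most \<open>t\<close>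
  points, whereas for \<open>i < j\<close> the still white \<open>w\<^sub>j\<close> is not a neighbour of \<open>v\<^sub>i\<close>, so they meet in
  more than \<open>t\<close> points. The number of forces is therefore bounded by Fueredi's threshold version of
  the skew Bollobas inequality.

  For that inequality, identify points with reals and let \<open>f\<^sub>A\<close> be the monic polynomial with root
  set \<open>A\<close>, where \<open>|A| = a\<close> and \<open>|B| = b\<close>. As for subresultants, \<open>|A \<inter> B| > t\<close> holds iff there is a
  nontrivial relation \<open>u f\<^sub>A + v f\<^sub>B = 0\<close> with \<open>deg u < b - t\<close> and \<open>deg v < a - t\<close>. Evaluating the
  polynomials \<open>x\<^sup>l f\<^sub>A\<close> and \<open>x\<^sup>l f\<^sub>B\<close> spanning these combinations at \<open>a + b - 2t\<close> points gives a
  square matrix. Its determinant vanishes if \<open>|A \<inter> B| > t\<close>, and for suitable points it is nonzero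
  for each of the finitely many diagonal pairs. Grouping the permutations in
  the Leibniz formula by the set \<open>P\<close> of rows sent to the first \<open>b - t\<close> columns separates \<open>A\<close> from
  \<open>B\<close>, so the determinants form a triangular matrix with nonzero diagonal and rank at most the
  number of sets \<open>P\<close>.
\<close>

section \<open>Determinants: Leibniz grouping, a rank bound, evaluation matrices\<close>

text \<open>The coefficients \<open>c\<close> are chosen before \<alpha> and \<beta>, so one family
  serves all pairs of sets; this turns the determinants into entries of a matrix product indexed by
  \<open>P\<close>.\<close>

lemma det_scaled_columns_expansion:
  fixes m :: "nat \<Rightarrow> nat \<Rightarrow> real"
  assumes "r \<le> D"
  shows "\<exists>c. \<forall>\<alpha> \<beta>. det (mat D D (\<lambda>(p, j). m p j * (if j < r then \<alpha> p else \<beta> p))) =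
    (\<Sum>P | P \<subseteq> {0..<D} \<and> card P = r. c P * prod \<alpha> P * prod \<beta> ({0..<D} - P))"
\<comment> \<open>The witness for \<open>c\<close> stays schematic until the end: \<open>c P\<close>
  is the Leibniz sum of the unscaled matrix over the permutations sending exactly the rows in
  \<open>P\<close> to columns below \<open>r\<close>.\<close>
proof (intro exI allI)
  fix \<alpha> \<beta> :: "nat \<Rightarrow> real"
  let ?S = "{\<sigma>. \<sigma> permutes {0..<D}}"
  let ?Q = "{P. P \<subseteq> {0..<D} \<and> card P = r}"
  let ?g = "\<lambda>\<sigma> :: nat \<Rightarrow> nat. {p \<in> {0..<D}. \<sigma> p < r}"
  let ?w = "\<lambda>\<sigma>. signof \<sigma> * (\<Prod>p = 0..<D. m p (\<sigma> p))"
  have card_g: "card (?g \<sigma>) = r" if "\<sigma> permutes {0..<D}" for \<sigma>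
  proof -
    have "\<sigma> ` ?g \<sigma> = {0..<r}"
    proof
      show "{0..<r} \<subseteq> \<sigma> ` ?g \<sigma>"
      proof
        fix j assume j: "j \<in> {0..<r}"
        then have "j \<in> \<sigma> ` {0..<D}" using assms permutes_image[OF that] by auto
        then show "j \<in> \<sigma> ` ?g \<sigma>" using j by auto
      qed
    qed auto
    moreover have "inj_on \<sigma> (?g \<sigma>)" using permutes_inj_on[OF that] .
    ultimately show ?thesis by (metis card_image card_atLeastLessThan diff_zero)
  qed
  have fin: "finite ?S" "finite ?Q" by (auto simp: finite_permutations)
  have "det (mat D D (\<lambda>(p, j). m p j * (if j < r then \<alpha> p else \<beta> p))) =
    (\<Sum>\<sigma>\<in>?S. ?w \<sigma> * (\<Prod>p = 0..<D. if \<sigma> p < r then \<alpha> p else \<beta> p))"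
    (is "det ?M = _")
  proof -
    have "det ?M = (\<Sum>\<sigma>\<in>?S. signof \<sigma> * (\<Prod>p = 0..<D. ?M $$ (p, \<sigma> p)))"
      by (rule det_def') simp
    also have "\<dots> = (\<Sum>\<sigma>\<in>?S. signof \<sigma> *
        (\<Prod>p = 0..<D. m p (\<sigma> p) * (if \<sigma> p < r then \<alpha> p else \<beta> p)))"
    proof (intro sum.cong refl arg_cong2[where f = "(*)"] prod.cong)
      fix \<sigma> p assume "\<sigma> \<in> ?S" "p \<in> {0..<D}"
      then have "\<sigma> p < D" using permutes_in_image[of \<sigma> "{0..<D}" p] by auto
      with \<open>p \<in> {0..<D}\<close> show "?M $$ (p, \<sigma> p) = m p (\<sigma> p) * (if \<sigma> p < r then \<alpha> p else \<beta> p)"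
        by simp
    qed
    finally show ?thesis by (simp only: prod.distrib mult.assoc)
  qed
  also have "\<dots> = (\<Sum>\<sigma>\<in>?S. ?w \<sigma> * (prod \<alpha> (?g \<sigma>) * prod \<beta> ({0..<D} - ?g \<sigma>)))"
  proof (intro sum.cong refl arg_cong2[where f = "(*)"])
    fix \<sigma> :: "nat \<Rightarrow> nat"
    have "{0..<D} \<inter> - {p. \<sigma> p < r} = {0..<D} - ?g \<sigma>" "{0..<D} \<inter> {p. \<sigma> p < r} = ?g \<sigma>" by auto
    then show "(\<Prod>p = 0..<D. if \<sigma> p < r then \<alpha> p else \<beta> p) =
        prod \<alpha> (?g \<sigma>) * prod \<beta> ({0..<D} - ?g \<sigma>)"
      by (subst prod.If_cases) simp_all
  qed
  also have "\<dots> = (\<Sum>P\<in>?Q. \<Sum>\<sigma> | \<sigma> \<in> ?S \<and> ?g \<sigma> = P.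
      ?w \<sigma> * (prod \<alpha> (?g \<sigma>) * prod \<beta> ({0..<D} - ?g \<sigma>)))"
    using card_g by (intro sum.group[symmetric] fin) auto
  also have "\<dots> = (\<Sum>P\<in>?Q. (\<Sum>\<sigma> | \<sigma> \<in> ?S \<and> ?g \<sigma> = P. ?w \<sigma>) * prod \<alpha> P * prod \<beta> ({0..<D} - P))"
    by (intro sum.cong refl) (simp add: sum_distrib_right mult.assoc)
  finally show "det (mat D D (\<lambda>(p, j). m p j * (if j < r then \<alpha> p else \<beta> p))) =
    (\<Sum>P\<in>?Q. (\<Sum>\<sigma> | \<sigma> \<in> ?S \<and> ?g \<sigma> = P. ?w \<sigma>) * prod \<alpha> P * prod \<beta> ({0..<D} - P))" .
qed

text \<open>With fewer than \<open>m\<close> indices, zero padding gives the left factor a zero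
  column, so the product would be singular although triangular with nonzero diagonal.\<close>

lemma triangular_factorization_bound:
  fixes f :: "nat \<Rightarrow> 'q \<Rightarrow> real" and g :: "'q \<Rightarrow> nat \<Rightarrow> real"
  assumes "finite Q"
    and diag: "\<And>i. i < m \<Longrightarrow> (\<Sum>P\<in>Q. f i P * g P i) \<noteq> 0"
    and upper: "\<And>i j. i < j \<Longrightarrow> j < m \<Longrightarrow> (\<Sum>P\<in>Q. f i P * g P j) = 0"
  shows "m \<le> card Q"
proof (rule ccontr)
  assume "\<not> m \<le> card Q"
  then have lt: "card Q < m" by simp
  obtain e where e: "bij_betw e {0..<card Q} Q"
    using ex_bij_betw_nat_finite[OF \<open>finite Q\<close>] by blast
  let ?X = "mat m m (\<lambda>(i, l). if l < card Q then f i (e l) else 0)"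
  \<comment> \<open>Rows from \<open>card Q\<close> on hold arbitrary values; they only meet the
    zero columns of \<open>?X\<close>.\<close>
  let ?Y = "mat m m (\<lambda>(l, j). g (e l) j)"
  have entry: "(?X * ?Y) $$ (i, j) = (\<Sum>P\<in>Q. f i P * g P j)" if "i < m" "j < m" for i j
  proof -
    have "(?X * ?Y) $$ (i, j) = (\<Sum>l = 0..<m. if l < card Q then f i (e l) * g (e l) j else 0)"
      using that by (auto simp: scalar_prod_def intro!: sum.cong)
    also have "\<dots> = (\<Sum>l = 0..<card Q. f i (e l) * g (e l) j)"
      using lt by (intro sum.mono_neutral_cong_right) auto
    also have "\<dots> = (\<Sum>P\<in>Q. f i P * g P j)"
      using sum.reindex_bij_betw[OF e, of "\<lambda>P. f i P * g P j"] .
    finally show ?thesis .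
  qed
  have "det (?X * ?Y) = prod_list (diag_mat (?X * ?Y))"
  proof (rule det_lower_triangular)
    fix i j assume ij: "i < j" "j < m"
    then show "(?X * ?Y) $$ (i, j) = 0" by (simp only: entry less_trans[OF ij] upper)
  qed (simp add: mult_carrier_mat[of _ m m])
  also have "\<dots> = (\<Prod>i = 0..<m. (?X * ?Y) $$ (i, i))"
    by (simp add: prod_list_diag_prod)
  also have "\<dots> = (\<Prod>i = 0..<m. \<Sum>P\<in>Q. f i P * g P i)"
    by (intro prod.cong refl entry) auto
  also have "\<dots> \<noteq> 0" using diag by auto
  finally have "det ?X \<noteq> 0"
    by (subst (asm) det_mult[of _ m]) auto
  moreover have "?X *\<^sub>v unit_vec m (card Q) = 0\<^sub>v m"
    using lt by (intro eq_vecI) (auto simp: scalar_prod_def unit_vec_def intro!: sum.neutral)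
  then have "det ?X = 0"
    using lt by (subst det_0_iff_vec_prod_zero[of _ m]) (auto intro!: exI[of _ "unit_vec m (card Q)"])
  ultimately show False by simp
qed

text \<open>Points are added one at a time: expansion along the new row makes each determinant a
  nonzero polynomial in the new point, and finitely many of these have finitely many roots to
  avoid.\<close>

lemma generic_evaluation_points:
  fixes h :: "'i \<Rightarrow> nat \<Rightarrow> real poly"
  assumes "finite I"
    and "\<And>i c. i \<in> I \<Longrightarrow> (\<Sum>j<D. smult (c j) (h i j)) = 0 \<Longrightarrow> \<forall>j<D. c j = 0"
  shows "\<exists>x. \<forall>i\<in>I. det (mat D D (\<lambda>(p, j). poly (h i j) (x p))) \<noteq> 0"
  using assms(2)
proof (induction D)
  case 0
  then show ?case by (simp add: det_dim_zero)
next
  case (Suc D)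
  have indep: "\<forall>j<D. c j = 0" if "i \<in> I" "(\<Sum>j<D. smult (c j) (h i j)) = 0" for i c
  proof -
    have "(\<Sum>j<Suc D. smult (if j < D then c j else 0) (h i j)) = 0" using that(2) by simp
    from Suc.prems[OF that(1) this] show ?thesis by (metis less_SucI)
  qed
  have "\<exists>x. \<forall>i\<in>I. det (mat D D (\<lambda>(p, j). poly (h i j) (x p))) \<noteq> 0"
    by (rule Suc.IH) (rule indep)
  then obtain x where
    x: "\<And>i. i \<in> I \<Longrightarrow> det (mat D D (\<lambda>(p, j). poly (h i j) (x p))) \<noteq> 0" by blast
  define N where "N i y = mat (Suc D) (Suc D) (\<lambda>(p, j). poly (h i j) (if p = D then y else x p))" for i y
  \<comment> \<open>The \<open>0\<close> is a placeholder: cofactors along row \<open>D\<close> do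
    not involve the new point.\<close>
  define q where "q i = (\<Sum>j<Suc D. smult (cofactor (N i 0) D j) (h i j))" for i
  have cof: "cofactor (N i y) D j = cofactor (N i 0) D j" if "j < Suc D" for i y j
  proof -
    have "mat_delete (N i y) D j = mat_delete (N i 0) D j"
      using that unfolding N_def mat_delete_def by (intro eq_matI) auto
    then show ?thesis by (simp add: cofactor_def)
  qed
  have det_N: "det (N i y) = poly (q i) y" for i y
  proof -
    have "det (N i y) = (\<Sum>j<Suc D. N i y $$ (D, j) * cofactor (N i y) D j)"
      by (rule laplace_expansion_row) (auto simp: N_def)
    also have "\<dots> = (\<Sum>j<Suc D. poly (h i j) y * cofactor (N i 0) D j)"
      by (intro sum.cong refl arg_cong2[where f = "(*)"] cof) (auto simp: N_def)
    also have "\<dots> = poly (q i) y" by (simp add: q_def poly_sum mult.commute)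
    finally show ?thesis .
  qed
  \<comment> \<open>The coefficient of \<open>h i D\<close> in \<open>q i\<close> is the minor on the old points, nonzero by induction.\<close>
  have "q i \<noteq> 0" if "i \<in> I" for i
  proof
    assume "q i = 0"
    then have "cofactor (N i 0) D D = 0" using Suc.prems[OF that] unfolding q_def by blast
    moreover have "mat_delete (N i 0) D D = mat D D (\<lambda>(p, j). poly (h i j) (x p))"
      unfolding N_def mat_delete_def by (intro eq_matI) auto
    ultimately show False using x[OF that] by (simp add: cofactor_def)
  qed
  then have "finite (\<Union>i\<in>I. {y. poly (q i) y = 0})" using \<open>finite I\<close> poly_roots_finite by blast
  then obtain y where "y \<notin> (\<Union>i\<in>I. {y. poly (q i) y = 0})"
    using ex_new_if_finite[OF infinite_UNIV_char_0] by blast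
  then have "\<forall>i\<in>I. det (N i y) \<noteq> 0" using det_N by auto
  then show ?case unfolding N_def by (intro exI[of _ "\<lambda>p. if p = D then y else x p"])
qed

section \<open>Root polynomials and Sylvester-type relations\<close>

definition root_poly :: "real set \<Rightarrow> real poly" where
  "root_poly A = (\<Prod>a\<in>A. [:- a, 1:])"

lemma poly_root_poly_eq_0_iff: "finite A \<Longrightarrow> poly (root_poly A) x = 0 \<longleftrightarrow> x \<in> A"
  by (auto simp: root_poly_def poly_prod)

lemma root_poly_nonzero: "finite A \<Longrightarrow> root_poly A \<noteq> 0"
  by (simp add: root_poly_def)

lemma degree_root_poly: "degree (root_poly A) = card A"
  by (simp add: root_poly_def degree_prod_eq_sum_degree)

lemma root_poly_union: "finite A \<Longrightarrow> finite B \<Longrightarrow> A \<inter> B = {} \<Longrightarrow>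
    root_poly (A \<union> B) = root_poly A * root_poly B"
  by (simp add: root_poly_def prod.union_disjoint)

text \<open>These are the shifts in a subresultant matrix; a coefficient vector of length
  \<open>r + s\<close> lists the multiplier of \<open>root_poly A\<close>, then that of
  \<open>root_poly B\<close>.\<close>

definition sylvester_family :: "nat \<Rightarrow> real set \<Rightarrow> real set \<Rightarrow> nat \<Rightarrow> real poly" where
  "sylvester_family r A B j =
     (if j < r then monom 1 j * root_poly A else monom 1 (j - r) * root_poly B)"

lemma sum_sylvester_family:
  "(\<Sum>j<r + s. smult (c j) (sylvester_family r A B j)) =
     (\<Sum>j<r. monom (c j) j) * root_poly A + (\<Sum>j<s. monom (c (r + j)) j) * root_poly B"
proof -
  have "(\<Sum>j<r + s. smult (c j) (sylvester_family r A B j)) =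
    (\<Sum>j<r. smult (c j) (sylvester_family r A B j)) +
    (\<Sum>j<s. smult (c (r + j)) (sylvester_family r A B (r + j)))"
    by (induction s) (simp_all add: add.assoc)
  also have "\<dots> = (\<Sum>j<r. monom (c j) j * root_poly A) + (\<Sum>j<s. monom (c (r + j)) j * root_poly B)"
    by (simp add: sylvester_family_def smult_monom flip: mult_smult_left)
  finally show ?thesis by (simp add: sum_distrib_right)
qed

lemma coeff_sum_monom: "coeff (\<Sum>j<s. monom (c j) j) l = (if l < s then c l else 0)"
  by (simp add: coeff_sum)

lemma poly_eq_sum_monom: "degree p < s \<Longrightarrow> (\<Sum>j<s. monom (coeff p j) j) = p"
  by (rule poly_eqI) (auto simp: coeff_sum_monom coeff_eq_0)

lemma many_roots_imp_zero:
  fixes c :: "nat \<Rightarrow> real"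
  assumes "finite R" "s \<le> card R" "\<And>a. a \<in> R \<Longrightarrow> poly (\<Sum>j<s. monom (c j) j) a = 0"
  shows "(\<Sum>j<s. monom (c j) j) = 0"
proof (rule ccontr)
  let ?v = "\<Sum>j<s. monom (c j) j"
  assume nz: "?v \<noteq> 0"
  then have "coeff ?v (degree ?v) \<noteq> 0" by simp
  then have "degree ?v < s" by (metis coeff_sum_monom)
  moreover have "card R \<le> card {x. poly ?v x = 0}"
    using assms(3) by (intro card_mono poly_roots_finite nz) auto
  moreover have "card {x. poly ?v x = 0} \<le> degree ?v" by (rule card_poly_roots_bound[OF nz])
  ultimately show False using assms(2) by simp
qed

text \<open>On \<open>A - B\<close> the first product vanishes and \<open>root_poly B\<close> does
  not, so the second multiplier, of degree below \<open>s\<close>, has at least \<open>s\<close>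
  roots.\<close>

lemma sylvester_family_independent:
  assumes fin: "finite A" "finite B" and "s \<le> card (A - B)"
    and 0: "(\<Sum>j<r + s. smult (c j) (sylvester_family r A B j)) = 0"
  shows "\<forall>j<r + s. c j = 0"
proof -
  let ?u = "\<Sum>j<r. monom (c j) j" and ?v = "\<Sum>j<s. monom (c (r + j)) j"
  have uv: "?u * root_poly A + ?v * root_poly B = 0" using 0 by (simp add: sum_sylvester_family)
  have v: "?v = 0"
  proof (rule many_roots_imp_zero)
    fix a assume a: "a \<in> A - B"
    have "poly (?u * root_poly A + ?v * root_poly B) a = 0" by (simp only: uv poly_0)
    with a show "poly ?v a = 0" using fin
      by (simp add: poly_root_poly_eq_0_iff[THEN iffD2] poly_root_poly_eq_0_iff)
  qed (use assms in auto)
  with uv have u: "?u = 0" using root_poly_nonzero[OF fin(1)] by simp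
  show ?thesis
  proof (intro allI impI)
    fix j assume j: "j < r + s"
    show "c j = 0"
    proof (cases "j < r")
      case True
      then have "coeff ?u j = c j" by (simp add: coeff_sum_monom)
      then show ?thesis by (simp add: u)
    next
      case False
      then have "coeff ?v (j - r) = c j" using j by (simp add: coeff_sum_monom[of "\<lambda>j. c (r + j)"])
      then show ?thesis by (simp add: v)
    qed
  qed
qed

text \<open>Both \<open>root_poly (B - A) * root_poly A\<close> and
  \<open>root_poly (A - B) * root_poly B\<close> equal \<open>root_poly (A \<union> B)\<close>. This
  relation yields a kernel vector for any choice of points.\<close>

lemma det_sylvester_family_eq_0:
  assumes fin: "finite A" "finite B" and r: "card (B - A) < r" and s: "card (A - B) < s"
  shows "det (mat (r + s) (r + s) (\<lambda>(p, j). poly (sylvester_family r A B j) (x p))) = 0"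
proof -
  define c where "c j = (if j < r then coeff (root_poly (B - A)) j
    else coeff (- root_poly (A - B)) (j - r))" for j
  have "(\<Sum>j<r. monom (c j) j) = root_poly (B - A)"
    using poly_eq_sum_monom[of "root_poly (B - A)" r] r by (simp add: c_def degree_root_poly)
  moreover have "(\<Sum>j<s. monom (c (r + j)) j) = - root_poly (A - B)"
    using poly_eq_sum_monom[of "- root_poly (A - B)" s] s by (simp add: c_def degree_root_poly)
  moreover have "root_poly (B - A) * root_poly A = root_poly (A - B) * root_poly B"
  proof -
    have "root_poly ((B - A) \<union> A) = root_poly ((A - B) \<union> B)"
      by (rule arg_cong[where f = root_poly]) auto
    moreover have "(B - A) \<inter> A = {}" "(A - B) \<inter> B = {}" by auto
    ultimately show ?thesis using fin by (metis root_poly_union finite_Diff)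
  qed
  ultimately have 0: "(\<Sum>j<r + s. smult (c j) (sylvester_family r A B j)) = 0"
    by (simp add: sum_sylvester_family)
  let ?M = "mat (r + s) (r + s) (\<lambda>(p, j). poly (sylvester_family r A B j) (x p))"
  have "?M *\<^sub>v vec (r + s) c = 0\<^sub>v (r + s)"
  proof (intro eq_vecI)
    fix p assume p: "p < dim_vec (0\<^sub>v (r + s) :: real vec)"
    have "poly (\<Sum>j<r + s. smult (c j) (sylvester_family r A B j)) (x p) = 0" by (simp add: 0)
    then show "(?M *\<^sub>v vec (r + s) c) $ p = 0\<^sub>v (r + s) $ p"
      using p by (simp add: scalar_prod_def poly_sum mult.commute atLeast0LessThan)
  qed simp
  moreover have "vec (r + s) c \<noteq> 0\<^sub>v (r + s)"
  proof
    assume "vec (r + s) c = 0\<^sub>v (r + s)"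
    \<comment> \<open>This index is the degree of the first multiplier and lies below
      \<open>r\<close>, so the entry is a leading coefficient.\<close>
    then have "vec (r + s) c $ card (B - A) = 0\<^sub>v (r + s) $ card (B - A)" by simp
    then have "lead_coeff (root_poly (B - A)) = 0" using r by (simp add: c_def degree_root_poly)
    then show False using root_poly_nonzero fin by auto
  qed
  ultimately show ?thesis
    by (subst det_0_iff_vec_prod_zero[of _ "r + s"]) (auto intro!: exI[of _ "vec (r + s) c"])
qed

section \<open>The threshold skew Bollobas inequality\<close>

lemma skew_bollobas_threshold_real:
  fixes A B :: "nat \<Rightarrow> real set"
  assumes A: "\<And>i. i < m \<Longrightarrow> finite (A i) \<and> card (A i) = a"
    and B: "\<And>i. i < m \<Longrightarrow> finite (B i) \<and> card (B i) = b"
    and "t \<le> a" "t \<le> b"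
    and diag: "\<And>i. i < m \<Longrightarrow> card (A i \<inter> B i) \<le> t"
    and upper: "\<And>i j. i < j \<Longrightarrow> j < m \<Longrightarrow> t < card (A i \<inter> B j)"
  shows "m \<le> (a + b - 2 * t) choose (b - t)"
proof -
  \<comment> \<open>An intersection of size at most \<open>t\<close> leaves at least
    \<open>s\<close> points in \<open>A i - B i\<close>; a larger one leaves fewer than
    \<open>s\<close> and \<open>r\<close> points in the two differences.\<close>
  define r s where "r = b - t" and "s = a - t"
  have rs: "r + s = a + b - 2 * t" using assms(3,4) by (simp add: r_def s_def)
  let ?M = "\<lambda>x i j. mat (r + s) (r + s) (\<lambda>(p, l). poly (sylvester_family r (A i) (B j) l) (x p))"
  have cards: "card (A i - B j) = a - card (A i \<inter> B j)" "card (B j - A i) = b - card (A i \<inter> B j)"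
    if "i < m" "j < m" for i j
    using that A B by (auto simp: card_Diff_subset_Int Int_commute)
  have "\<exists>x. \<forall>i\<in>{..<m}. det (?M x i i) \<noteq> 0"
  proof (rule generic_evaluation_points[where h = "\<lambda>i. sylvester_family r (A i) (B i)"])
    fix i c assume i: "i \<in> {..<m}"
      and "(\<Sum>j<r + s. smult (c j) (sylvester_family r (A i) (B i) j)) = 0"
    then show "\<forall>j<r + s. c j = 0"
      using A[of i] B[of i] diag[of i] cards[of i i]
      by (intro sylvester_family_independent[of "A i" "B i"]) (auto simp: s_def intro: diff_le_mono2)
  qed simp
  then obtain x where x: "\<And>i. i < m \<Longrightarrow> det (?M x i i) \<noteq> 0" by blast
  have zero: "det (?M x i j) = 0" if "i < j" "j < m" for i j
    using that A[of i] B[of j] upper[OF that] cards[of i j] card_mono[of "A i" "A i \<inter> B j"]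
      card_mono[of "B j" "A i \<inter> B j"]
    by (intro det_sylvester_family_eq_0) (auto simp: r_def s_def)
  \<comment> \<open>The powers of \<open>x p\<close> form the fixed matrix; the values of the root
    polynomials are the scalings \<alpha> and \<beta>.\<close>
  obtain c where c: "\<And>\<alpha> \<beta>. det (mat (r + s) (r + s)
      (\<lambda>(p, l). x p ^ (if l < r then l else l - r) * (if l < r then \<alpha> p else \<beta> p))) =
    (\<Sum>P | P \<subseteq> {0..<r + s} \<and> card P = r. c P * prod \<alpha> P * prod \<beta> ({0..<r + s} - P))"
    using det_scaled_columns_expansion[of r "r + s" "\<lambda>p l. x p ^ (if l < r then l else l - r)"] by auto
  let ?Q = "{P. P \<subseteq> {0..<r + s} \<and> card P = r}"
  let ?f = "\<lambda>i P. c P * (\<Prod>p\<in>P. poly (root_poly (A i)) (x p))"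
  let ?g = "\<lambda>P j. \<Prod>p\<in>{0..<r + s} - P. poly (root_poly (B j)) (x p)"
  have M: "det (?M x i j) = (\<Sum>P\<in>?Q. ?f i P * ?g P j)" for i j
  proof -
    have "?M x i j = mat (r + s) (r + s) (\<lambda>(p, l). x p ^ (if l < r then l else l - r) *
        (if l < r then poly (root_poly (A i)) (x p) else poly (root_poly (B j)) (x p)))"
      by (rule cong_mat) (auto simp: sylvester_family_def poly_monom)
    then show ?thesis by (simp only: c)
  qed
  have "m \<le> card ?Q"
    by (rule triangular_factorization_bound[of _ _ ?f ?g]) (use x zero in \<open>simp_all flip: M\<close>)
  also have "card ?Q = (r + s) choose r" using n_subsets[of "{0..<r + s}" r] by simp
  finally show ?thesis by (simp only: rs flip: r_def)
qed

text \<open>Only finitely many points occur, and an injection of them into the reals preserves all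
  cardinalities involved.\<close>

theorem skew_bollobas_threshold:
  fixes A B :: "nat \<Rightarrow> 'a set"
  assumes A: "\<And>i. i < m \<Longrightarrow> finite (A i) \<and> card (A i) = a"
    and B: "\<And>i. i < m \<Longrightarrow> finite (B i) \<and> card (B i) = b"
    and "t \<le> a" "t \<le> b"
    and diag: "\<And>i. i < m \<Longrightarrow> card (A i \<inter> B i) \<le> t"
    and upper: "\<And>i j. i < j \<Longrightarrow> j < m \<Longrightarrow> t < card (A i \<inter> B j)"
  shows "m \<le> (a + b - 2 * t) choose (b - t)"
proof -
  let ?U = "\<Union>i<m. A i \<union> B i"
  have "finite ?U" using A B by auto
  then obtain f :: "'a \<Rightarrow> nat" where "inj_on f ?U" using finite_imp_inj_to_nat_seg by metis
  then have inj: "inj_on (\<lambda>x. real (f x)) ?U" by (simp add: inj_on_def)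
  let ?e = "\<lambda>X. (\<lambda>x. real (f x)) ` X"
  have card_e: "card (?e X) = card X" if "X \<subseteq> ?U" for X
    using card_image inj_on_subset[OF inj that] by blast
  have inter: "card (?e (A i) \<inter> ?e (B j)) = card (A i \<inter> B j)" if "i < m" "j < m" for i j
  proof -
    have sub: "A i \<subseteq> ?U" "B j \<subseteq> ?U" using that by auto
    then have "?e (A i) \<inter> ?e (B j) = ?e (A i \<inter> B j)" by (rule inj_on_image_Int[OF inj, symmetric])
    moreover have "A i \<inter> B j \<subseteq> ?U" using sub by auto
    ultimately show ?thesis using card_e by simp
  qed
  have sub: "A i \<subseteq> ?U" "B i \<subseteq> ?U" if "i < m" for i using that by auto
  show ?thesis
    by (rule skew_bollobas_threshold_real[of m "\<lambda>i. ?e (A i)" a "\<lambda>i. ?e (B i)" b t])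
      (use assms in \<open>simp_all add: inter card_e[OF sub(1)] card_e[OF sub(2)]\<close>)
qed

section \<open>Zero forcing and the Johnson graph\<close>

text \<open>When \<open>v\<close> forces \<open>w\<close>, \<open>v\<close> is already black and
  \<open>w\<close> is its only white neighbor, so a vertex \<open>w'\<close> forced later is neither
  \<open>v\<close> nor adjacent to it.\<close>

lemma zero_forcing_chronological_list:
  assumes "(force_step G)\<^sup>*\<^sup>* B (pverts G)" "finite (pverts G)"
  shows "\<exists>xs. card (pverts G) = card B + length xs \<and> B \<subseteq> pverts G \<and>
    (\<forall>(v, w) \<in> set xs. (v, w) \<in> parcs G \<and> w \<in> pverts G - B) \<and>
    sorted_wrt (\<lambda>(v, w) (v', w'). v \<noteq> w' \<and> (v, w') \<notin> parcs G) xs"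
  using assms(1)
proof (induction rule: converse_rtranclp_induct)
  case base
  show ?case by (intro exI[of _ "[]"]) simp
next
  case (step B B')
  from step.hyps(1) obtain v w where v: "v \<in> B" and white: "white_neighbors G B v = {w}"
    and B': "B' = insert w B"
    unfolding force_step_def by blast
  from white have w: "w \<in> pverts G - B" "(v, w) \<in> parcs G"
    and other: "\<And>w'. w' \<in> pverts G - B' \<Longrightarrow> (v, w') \<notin> parcs G"
    unfolding white_neighbors_def B' by blast+
  from step.IH obtain xs where xs: "card (pverts G) = card B' + length xs" "B' \<subseteq> pverts G"
    "\<forall>(v, w) \<in> set xs. (v, w) \<in> parcs G \<and> w \<in> pverts G - B'"
    "sorted_wrt (\<lambda>(v, w) (v', w'). v \<noteq> w' \<and> (v, w') \<notin> parcs G) xs"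
    by (elim exE conjE) (rule that)
  have "finite B" using finite_subset[OF xs(2) assms(2)] B' by simp
  then have "card B' = Suc (card B)" using w(1) B' by simp
  moreover have "\<forall>(v', w') \<in> set xs. v \<noteq> w' \<and> (v, w') \<notin> parcs G"
    using xs(3) v other B' by blast
  moreover have "\<forall>(v, w) \<in> set ((v, w) # xs). (v, w) \<in> parcs G \<and> w \<in> pverts G - B"
    using xs(3) w B' by auto
  ultimately show ?case using xs(1,2,4) B'
    by (intro exI[of _ "(v, w) # xs"] conjI) (simp_all add: case_prod_unfold)
qed

theorem theorem4p4:
  fixes n k t :: nat and S :: "nat set"
  assumes "n > 0" and "k > 0" and "n \<ge> 2 * k + 1"
    and "t \<in> {0..k - 1}" and "S = {0..t}"
  shows "int (zero_forcing_number (gen_johnson S n k))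
           \<ge> int (n choose k) - int ((2 * k - 2 * t) choose (k - t))"
proof -
  let ?G = "gen_johnson S n k"
  have verts: "pverts ?G = {A. A \<subseteq> {1..n} \<and> card A = k}" by (simp add: gen_johnson_def)
  have fin: "finite (pverts ?G)" by (simp add: verts)
  have card_verts: "card (pverts ?G) = n choose k" using n_subsets[of "{1..n}" k] by (simp add: verts)
  obtain Z where Z: "zero_forcing_set ?G Z" "card Z = zero_forcing_number ?G"
    using zero_forcing_number_attained by blast
  then have forces: "(force_step ?G)\<^sup>*\<^sup>* Z (pverts ?G)" by (simp add: zero_forcing_set_def)
  obtain xs where xs: "card (pverts ?G) = card Z + length xs"
    "\<forall>(v, w) \<in> set xs. (v, w) \<in> parcs ?G \<and> w \<in> pverts ?G - Z"
    "sorted_wrt (\<lambda>(v, w) (v', w'). v \<noteq> w' \<and> (v, w') \<notin> parcs ?G) xs"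
    using zero_forcing_chronological_list[OF forces fin] by (elim exE conjE) (rule that)
  have arc: "(fst (xs ! i), snd (xs ! i)) \<in> parcs ?G" if "i < length xs" for i
    using bspec[OF xs(2) nth_mem[OF that]] by (simp add: case_prod_unfold)
  \<comment> \<open>Forcing and forced vertices are all \<open>k\<close>-sets, so both set sizes in
    the inequality are \<open>k\<close>.\<close>
  have "length xs \<le> (k + k - 2 * t) choose (k - t)"
  proof (rule skew_bollobas_threshold[of _ "\<lambda>i. fst (xs ! i)" _ "\<lambda>i. snd (xs ! i)"])
    fix i assume i: "i < length xs"
    show "finite (fst (xs ! i)) \<and> card (fst (xs ! i)) = k"
      "finite (snd (xs ! i)) \<and> card (snd (xs ! i)) = k"
      "card (fst (xs ! i) \<inter> snd (xs ! i)) \<le> t"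
      using arc[OF i] assms(5) finite_subset[of _ "{1..n}"]
      by (simp_all add: gen_johnson_def case_prod_unfold)
  next
    fix i j assume ij: "i < j" "j < length xs"
    then have "fst (xs ! i) \<noteq> snd (xs ! j)" "(fst (xs ! i), snd (xs ! j)) \<notin> parcs ?G"
      using sorted_wrt_nth_less[OF xs(3) ij] by (auto simp: case_prod_unfold)
    then show "t < card (fst (xs ! i) \<inter> snd (xs ! j))"
      using arc[of i] arc[of j] ij assms(5) by (simp add: gen_johnson_def case_prod_unfold)
  qed (use assms(4) in auto)
  then show ?thesis using xs(1) Z(2) card_verts by (simp add: mult_2)
qed

end
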